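(* Let $T$ be a $\{1,3\}$-tree. Then the set of vertices of the polytope $\mathcal{P}_T$ is exactly $\{\frac12\mathbbm{1}_H : H \text{ is a collection of pairwise vertex-disjoint leaf-paths in } T\}$.
   Context: A $\{1,3\}$-tree is a finite tree all of whose nodes have degree $1$ (leaves) or $3$ (internal nodes). A leaf-edge is an edge incident with a leaf; a leaf-path is a path in $T$ whose two extreme edges are leaf-edges (a single edge joining two leaves is a leaf-path); the empty collection is allowed. $\mathbbm{1}_H\in\{0,1\}^E$ is the characteristic vector of the edge set of $H$, $E$ the edge set of $T$. $\mathcal{P}_T\subset\mathbb{R}^E$ is the set of $w$ such that for every internal node $v$ with incident edges $a,b,c$: $w_a\le w_b+w_c$, $w_b\le w_a+w_c$, $w_c\le w_a+w_b$, $w_a+w_b+w_c\le1$; and if $T$ is a single edge $e$, $\mathcal{P}_T=\{w:0\le w_e\le\frac12\}$. *)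

theory Defs
  imports "HOL-Analysis.Analysis"
begin

text \<open>
  A finite simple undirected graph is given by its node set \<open>V\<close> and the map \<open>ends\<close> sending an
  edge to the set of its two end nodes. The edge set \<open>E\<close> is the whole of the finite type \<open>'e\<close>, so
  that \<open>real ^ 'e\<close> is exactly the coordinate space indexed by \<open>E\<close>. Types being nonempty loses
  nothing here: a tree without edges is a single node of degree 0, hence not a \<open>{1,3}\<close>-tree.
\<close>

definition simple_graph :: "'v set \<Rightarrow> ('e::finite \<Rightarrow> 'v set) \<Rightarrow> bool" where
  "simple_graph V ends \<longleftrightarrow>
     finite V \<and> inj ends \<and> (\<forall>e. ends e \<subseteq> V \<and> card (ends e) = 2)"

definition incident_edges :: "('e::finite \<Rightarrow> 'v set) \<Rightarrow> 'v \<Rightarrow> 'e set" where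
  "incident_edges ends v = {e. v \<in> ends e}"

definition node_degree :: "('e::finite \<Rightarrow> 'v set) \<Rightarrow> 'v \<Rightarrow> nat" where
  "node_degree ends v = card (incident_edges ends v)"

definition graph_walk :: "'v set \<Rightarrow> ('e::finite \<Rightarrow> 'v set) \<Rightarrow> 'v list \<Rightarrow> 'e list \<Rightarrow> bool" where
  "graph_walk V ends vs es \<longleftrightarrow>
     set vs \<subseteq> V \<and> length vs = Suc (length es) \<and>
     (\<forall>i<length es. ends (es ! i) = {vs ! i, vs ! Suc i})"

definition graph_path :: "'v set \<Rightarrow> ('e::finite \<Rightarrow> 'v set) \<Rightarrow> 'v list \<Rightarrow> 'e list \<Rightarrow> bool" where
  "graph_path V ends vs es \<longleftrightarrow> graph_walk V ends vs es \<and> distinct vs"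

definition graph_connected :: "'v set \<Rightarrow> ('e::finite \<Rightarrow> 'v set) \<Rightarrow> bool" where
  "graph_connected V ends \<longleftrightarrow>
     V \<noteq> {} \<and> (\<forall>u\<in>V. \<forall>v\<in>V. \<exists>vs es. graph_walk V ends vs es \<and> hd vs = u \<and> last vs = v)"

text \<open>A cycle is a path with at least two edges together with an edge joining its end nodes.\<close>

definition graph_acyclic :: "'v set \<Rightarrow> ('e::finite \<Rightarrow> 'v set) \<Rightarrow> bool" where
  "graph_acyclic V ends \<longleftrightarrow>
     \<not> (\<exists>vs es e. graph_path V ends vs es \<and> 2 \<le> length es \<and> ends e = {hd vs, last vs})"

definition one_three_tree :: "'v set \<Rightarrow> ('e::finite \<Rightarrow> 'v set) \<Rightarrow> bool" where
  "one_three_tree V ends \<longleftrightarrow>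
     simple_graph V ends \<and> graph_connected V ends \<and> graph_acyclic V ends \<and>
     (\<forall>v\<in>V. node_degree ends v = 1 \<or> node_degree ends v = 3)"

definition leaf :: "'v set \<Rightarrow> ('e::finite \<Rightarrow> 'v set) \<Rightarrow> 'v \<Rightarrow> bool" where
  "leaf V ends v \<longleftrightarrow> v \<in> V \<and> node_degree ends v = 1"

definition internal_node :: "'v set \<Rightarrow> ('e::finite \<Rightarrow> 'v set) \<Rightarrow> 'v \<Rightarrow> bool" where
  "internal_node V ends v \<longleftrightarrow> v \<in> V \<and> node_degree ends v = 3"

definition leaf_edge :: "'v set \<Rightarrow> ('e::finite \<Rightarrow> 'v set) \<Rightarrow> 'e \<Rightarrow> bool" where
  "leaf_edge V ends e \<longleftrightarrow> (\<exists>v\<in>ends e. leaf V ends v)"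

text \<open>
  The last conjunct: a path with only one edge is a leaf-path only if that edge joins two leaves;
  an edge joining a leaf to an internal node is not a leaf-path.
\<close>

definition leaf_path :: "'v set \<Rightarrow> ('e::finite \<Rightarrow> 'v set) \<Rightarrow> 'v list \<Rightarrow> 'e list \<Rightarrow> bool" where
  "leaf_path V ends vs es \<longleftrightarrow>
     graph_path V ends vs es \<and> es \<noteq> [] \<and>
     leaf_edge V ends (hd es) \<and> leaf_edge V ends (last es) \<and>
     (length es = 1 \<longrightarrow> (\<forall>v\<in>set vs. leaf V ends v))"

text \<open>
  Paths are (node list, edge list) pairs. A path and its reversal are different pairs but share
  nodes, so a disjoint collection contains each path in at most one of its two directions.
\<close>

definition disjoint_leaf_paths ::
    "'v set \<Rightarrow> ('e::finite \<Rightarrow> 'v set) \<Rightarrow> ('v list \<times> 'e list) set \<Rightarrow> bool" where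
  "disjoint_leaf_paths V ends H \<longleftrightarrow>
     (\<forall>(vs, es)\<in>H. leaf_path V ends vs es) \<and>
     pairwise (\<lambda>p q. disjnt (set (fst p)) (set (fst q))) H"

definition edges_of :: "('v list \<times> 'e list) set \<Rightarrow> 'e set" where
  "edges_of H = (\<Union>(vs, es)\<in>H. set es)"

definition char_vec :: "'e set \<Rightarrow> real ^ ('e::finite)" where
  "char_vec F = (\<chi> e. indicator F e)"

definition tree_polytope :: "'v set \<Rightarrow> ('e::finite \<Rightarrow> 'v set) \<Rightarrow> (real ^ 'e) set" where
  "tree_polytope V ends = {w.
     (\<forall>v a b c. internal_node V ends v \<and> incident_edges ends v = {a, b, c} \<longrightarrow>
        w $ a \<le> w $ b + w $ c \<and> w $ b \<le> w $ a + w $ c \<and> w $ c \<le> w $ a + w $ b \<and>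
        w $ a + w $ b + w $ c \<le> 1) \<and>
     (\<forall>e. UNIV = {e} \<longrightarrow> 0 \<le> w $ e \<and> w $ e \<le> 1 / 2)}"

end

theory Submission
  imports Defs
begin

text \<open>
  The polytope lies in the box \<open>[0, 1/2]\<^sup>E\<close>, so its points with coordinates in \<open>{0, 1/2}\<close> are
  vertices. Such a point \<open>1/2 \<cdot> \<one>\<^sub>F\<close> lies in the polytope iff \<open>F\<close> has 0 or 2 edges at every internal
  node, and in a tree the components of such an \<open>F\<close> are disjoint leaf-paths.

  Conversely, let \<open>0 < w\<^sub>e < 1/2\<close> for some edge \<open>e\<close>. If \<open>a\<close> is such a fractional edge at an internal
  node \<open>v\<close>, then there is a second fractional edge \<open>b\<close> at \<open>v\<close> and a sign \<open>s\<close> such that moving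
  \<open>(w\<^sub>a, w\<^sub>b)\<close> slightly along \<open>\<plusminus>(1, s)\<close> respects the constraints at \<open>v\<close>. A longest path
  through \<open>e\<close> all of whose transitions are of this kind is a leaf-path, and the signs
  multiply along it to a direction in which \<open>w\<close> can be moved both ways. So \<open>w\<close> is not a vertex.
\<close>

section \<open>Paths in an arbitrary graph\<close>

lemma graph_path_rev:
  assumes "graph_path V ends vs es"
  shows "graph_path V ends (rev vs) (rev es)"
proof -
  have len: "length vs = Suc (length es)" and dist: "distinct vs" and sub: "set vs \<subseteq> V"
    and e: "\<And>i. i < length es \<Longrightarrow> ends (es ! i) = {vs ! i, vs ! Suc i}"
    using assms by (auto simp: graph_path_def graph_walk_def)
  have "ends (rev es ! i) = {rev vs ! i, rev vs ! Suc i}" if i: "i < length es" for i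
  proof -
    let ?j = "length es - Suc i"
    have "rev es ! i = es ! ?j" "rev vs ! i = vs ! Suc ?j" "rev vs ! Suc i = vs ! ?j"
      using i len by (auto simp: rev_nth Suc_diff_Suc)
    with e[of ?j] i show ?thesis by (auto simp: insert_commute)
  qed
  with len dist sub show ?thesis by (auto simp: graph_path_def graph_walk_def)
qed

lemma graph_path_snoc:
  assumes "graph_path V ends vs es" "ends f = {last vs, u}" "u \<in> V" "u \<notin> set vs"
  shows "graph_path V ends (vs @ [u]) (es @ [f])"
proof -
  have len: "length vs = Suc (length es)" and dist: "distinct vs" and sub: "set vs \<subseteq> V"
    and e: "\<And>i. i < length es \<Longrightarrow> ends (es ! i) = {vs ! i, vs ! Suc i}"
    using assms by (auto simp: graph_path_def graph_walk_def)
  have "last vs = vs ! length es" using len by (metis diff_Suc_1 last_conv_nth length_0_conv nat.distinct(1))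
  with len dist sub e assms show ?thesis
    by (auto simp: graph_path_def graph_walk_def nth_append less_Suc_eq)
qed

lemma graph_path_drop:
  assumes "graph_path V ends vs es" "j \<le> length es"
  shows "graph_path V ends (drop j vs) (drop j es)"
  using assms set_drop_subset[of j vs]
  by (auto simp: graph_path_def graph_walk_def)

lemma graph_path_incident_edge:
  assumes "graph_path V ends vs es" "e \<in> set es" "j < length vs" "vs ! j \<in> ends e"
  shows "(j < length es \<and> e = es ! j) \<or> (0 < j \<and> e = es ! (j - 1))"
proof -
  obtain i where i: "i < length es" "e = es ! i" using assms(2) by (auto simp: in_set_conv_nth)
  then have "vs ! j = vs ! i \<or> vs ! j = vs ! Suc i"
    using assms by (auto simp: graph_path_def graph_walk_def)
  moreover have "distinct vs" "length vs = Suc (length es)"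
    using assms by (auto simp: graph_path_def graph_walk_def)
  ultimately have "j = i \<or> j = Suc i" using i assms(3) by (auto simp: nth_eq_iff_index_eq)
  with i show ?thesis by auto
qed

lemma graph_path_edge_ends_subset:
  assumes "graph_path V ends vs es" "e \<in> set es"
  shows "ends e \<subseteq> set vs"
proof -
  obtain i where "i < length es" "e = es ! i" using assms(2) by (auto simp: in_set_conv_nth)
  with assms(1) show ?thesis by (auto simp: graph_path_def graph_walk_def)
qed

lemma graph_path_distinct_edges:
  assumes "graph_path V ends vs es"
  shows "distinct es"
proof -
  have len: "length vs = Suc (length es)" and dist: "distinct vs"
    and e: "\<And>i. i < length es \<Longrightarrow> ends (es ! i) = {vs ! i, vs ! Suc i}"
    using assms by (auto simp: graph_path_def graph_walk_def)
  have "es ! i \<noteq> es ! j" if "i < j" "j < length es" for i j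
  proof
    assume "es ! i = es ! j"
    then have "vs ! i \<in> {vs ! j, vs ! Suc j}" using e[of i] e[of j] that by auto
    then show False using that len dist by (auto simp: nth_eq_iff_index_eq)
  qed
  then show ?thesis by (metis distinct_conv_nth linorder_neqE_nat)
qed

section \<open>Constraints at a single node\<close>

lemma incident_edges_iff [simp]: "e \<in> incident_edges ends v \<longleftrightarrow> v \<in> ends e"
  by (simp add: incident_edges_def)

text \<open>The inequality \<open>2 * w $ a \<le> (\<Sum>e\<in>I. w $ e)\<close> is the triangle
  inequality for \<open>a\<close>, written so that the other two edges need not be named.\<close>

definition node_constraint :: "real ^ 'e::finite \<Rightarrow> 'e set \<Rightarrow> bool" where
  "node_constraint w I \<longleftrightarrow>
     (\<Sum>e\<in>I. w $ e) \<le> 1 \<and> (\<forall>a\<in>I. 2 * w $ a \<le> (\<Sum>e\<in>I. w $ e))"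

lemma node_constraint_cong:
  assumes "\<And>e. e \<in> I \<Longrightarrow> w $ e = w' $ e"
  shows "node_constraint w I = node_constraint w' I"
  using assms by (simp add: node_constraint_def)

lemma node_constraint_triple:
  assumes "a \<noteq> b" "a \<noteq> c" "b \<noteq> c"
  shows "node_constraint w {a, b, c} \<longleftrightarrow>
    w $ a \<le> w $ b + w $ c \<and> w $ b \<le> w $ a + w $ c \<and> w $ c \<le> w $ a + w $ b \<and>
    w $ a + w $ b + w $ c \<le> 1"
  using assms by (auto simp: node_constraint_def)

text \<open>
  Moving along \<open>(1, 1, 0)\<close> changes only the slacks \<open>\<gamma>\<close> and \<open>\<delta>\<close>, moving along \<open>(1, -1, 0)\<close> only
  \<open>\<alpha>\<close> and \<open>\<beta>\<close>, and similarly for the third coordinate. Since \<open>\<alpha> + \<delta> = 1 - 2 w\<^sub>a\<close> and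
  \<open>\<beta> + \<gamma> = 2 w\<^sub>a\<close> are positive, one of these four pairs of slacks is positive.
\<close>

lemma node_constraint_perturbation:
  assumes dist: "a \<noteq> b" "a \<noteq> c" "b \<noteq> c"
    and w: "node_constraint w {a, b, c}" and a: "0 < w $ a" "w $ a < 1 / 2"
  shows "\<exists>b' s \<epsilon>. b' \<in> {b, c} \<and> 0 < w $ b' \<and> w $ b' < 1 / 2 \<and> s \<in> {1, -1} \<and> 0 < \<epsilon> \<and>
    (\<forall>t. \<bar>t\<bar> \<le> \<epsilon> \<longrightarrow> node_constraint (w + t *\<^sub>R (axis a 1 + s *\<^sub>R axis b' 1)) {a, b, c})"
proof -
  define \<alpha> \<beta> \<gamma> \<delta> where "\<alpha> = w $ b + w $ c - w $ a" and "\<beta> = w $ a + w $ c - w $ b"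
    and "\<gamma> = w $ a + w $ b - w $ c" and "\<delta> = 1 - w $ a - w $ b - w $ c"
  note defs = \<alpha>_def \<beta>_def \<gamma>_def \<delta>_def
  have nonneg: "0 \<le> \<alpha>" "0 \<le> \<beta>" "0 \<le> \<gamma>" "0 \<le> \<delta>"
    using w by (auto simp: node_constraint_triple[OF dist] defs)
  have nc: "node_constraint (w + t *\<^sub>R (axis a 1 + s *\<^sub>R axis b 1)) {a, b, c} \<longleftrightarrow>
      0 \<le> \<alpha> + s * t - t \<and> 0 \<le> \<beta> + t - s * t \<and> 0 \<le> \<gamma> + t + s * t \<and> 0 \<le> \<delta> - t - s * t"
    "node_constraint (w + t *\<^sub>R (axis a 1 + s *\<^sub>R axis c 1)) {a, b, c} \<longleftrightarrow>
      0 \<le> \<alpha> + s * t - t \<and> 0 \<le> \<beta> + t + s * t \<and> 0 \<le> \<gamma> + t - s * t \<and> 0 \<le> \<delta> - t - s * t" for s t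
    using dist by (auto simp: node_constraint_triple[OF dist] defs axis_def algebra_simps)
  \<comment> \<open>In each case below the two positive slacks lie in different sums for the chosen
    edge, which puts its weight strictly between 0 and 1/2.\<close>
  have sums: "2 * w $ b = \<alpha> + \<gamma>" "2 * w $ c = \<alpha> + \<beta>"
    "1 - 2 * w $ b = \<beta> + \<delta>" "1 - 2 * w $ c = \<gamma> + \<delta>" by (auto simp: defs)
  have witness: ?thesis
    if "b' \<in> {b, c}" "0 < w $ b'" "w $ b' < 1 / 2" "s \<in> {1, -1}" "0 < \<epsilon>"
      "\<And>t. \<bar>t\<bar> \<le> \<epsilon> \<Longrightarrow> node_constraint (w + t *\<^sub>R (axis a 1 + s *\<^sub>R axis b' 1)) {a, b, c}"
    for b' s \<epsilon>
    using that by blast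
  have "0 < \<alpha> \<or> 0 < \<delta>" "0 < \<beta> \<or> 0 < \<gamma>" using a nonneg by (auto simp: defs)
  then consider (1) "0 < \<gamma>" "0 < \<delta>" | (2) "0 < \<alpha>" "0 < \<beta>" | (3) "0 < \<beta>" "0 < \<delta>" | (4) "0 < \<alpha>" "0 < \<gamma>" by blast
  then show ?thesis
  proof cases
    case 1
    \<comment> \<open>A slack that moves changes by 2 |t|, hence the radius is half the smaller of
      the two.\<close>
    show ?thesis
      by (rule witness[of b "1" "min \<gamma> \<delta> / 2"], unfold nc) (use 1 nonneg sums in auto)
  next
    case 2
    show ?thesis
      by (rule witness[of b "-1" "min \<alpha> \<beta> / 2"], unfold nc) (use 2 nonneg sums in auto)
  next
    case 3
    show ?thesis
      by (rule witness[of c "1" "min \<beta> \<delta> / 2"], unfold nc) (use 3 nonneg sums in auto)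
  next
    case 4
    show ?thesis
      by (rule witness[of c "-1" "min \<alpha> \<gamma> / 2"], unfold nc) (use 4 nonneg sums in auto)
  qed
qed

text \<open>Finitely many positive radii have a positive minimum. This joins perturbations that are
  feasible node by node into one for the whole tree.\<close>

lemma uniform_radius:
  fixes P :: "'a \<Rightarrow> real \<Rightarrow> bool"
  assumes "finite A" "\<And>x. \<exists>\<epsilon>>0. \<forall>t. \<bar>t\<bar> \<le> \<epsilon> \<longrightarrow> P x t"
  shows "\<exists>\<epsilon>>0. \<forall>x\<in>A. \<forall>t. \<bar>t\<bar> \<le> \<epsilon> \<longrightarrow> P x t"
  using assms(1)
proof (induction A rule: finite_induct)
  case empty
  show ?case by (intro exI[of _ 1]) simp
next
  case (insert x A)
  then obtain \<epsilon> where "\<epsilon> > 0" "\<forall>x\<in>A. \<forall>t. \<bar>t\<bar> \<le> \<epsilon> \<longrightarrow> P x t" by blast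
  moreover obtain \<epsilon>' where "\<epsilon>' > 0" "\<forall>t. \<bar>t\<bar> \<le> \<epsilon>' \<longrightarrow> P x t" using assms(2) by blast
  ultimately show ?case by (intro exI[of _ "min \<epsilon> \<epsilon>'"]) auto
qed

section \<open>Leaves, edges and path extension in a tree\<close>

locale one_three_tree_graph =
  fixes V :: "'v set" and ends :: "'e::finite \<Rightarrow> 'v set"
  assumes tree: "one_three_tree V ends"
begin

lemma finite_V: "finite V" and inj_ends: "inj ends" and ends_subset: "ends e \<subseteq> V"
  and card_ends: "card (ends e) = 2"
  using tree by (auto simp: one_three_tree_def simple_graph_def)

lemma leaf_or_internal: "v \<in> V \<Longrightarrow> leaf V ends v \<or> internal_node V ends v"
  using tree by (auto simp: one_three_tree_def leaf_def internal_node_def)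

lemma leaf_not_internal: "leaf V ends v \<Longrightarrow> \<not> internal_node V ends v"
  by (auto simp: leaf_def internal_node_def)

lemma leaf_edge_unique:
  assumes "leaf V ends v" "v \<in> ends e" "v \<in> ends f"
  shows "e = f"
proof -
  have "card (incident_edges ends v) = 1" using assms by (auto simp: leaf_def node_degree_def)
  then obtain x where "incident_edges ends v = {x}" by (auto simp: card_1_singleton_iff)
  then show ?thesis using assms incident_edges_iff by (metis singletonD)
qed

lemma other_end:
  assumes "v \<in> ends e"
  obtains u where "ends e = {v, u}" "u \<noteq> v" "u \<in> V"
proof -
  obtain x y where "ends e = {x, y}" "x \<noteq> y" using card_ends[of e] by (auto simp: card_2_iff)
  with assms ends_subset[of e] that show ?thesis by (auto simp: insert_commute)
qed

text \<open>The only use of acyclicity. If \<open>u\<close> were the last node but one,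
  \<open>f\<close> would be parallel to the last edge, against \<open>inj ends\<close>; if it came
  earlier, \<open>f\<close> would close a cycle with the part of the path from \<open>u\<close>
  on.\<close>

lemma next_edge_leaves_path:
  assumes p: "graph_path V ends vs es" and ne: "es \<noteq> []"
    and f: "ends f = {last vs, u}" "f \<noteq> last es" "u \<noteq> last vs"
  shows "u \<notin> set vs"
proof
  assume "u \<in> set vs"
  then obtain j where j: "j < length vs" "vs ! j = u" by (auto simp: in_set_conv_nth)
  have len: "length vs = Suc (length es)"
    and e: "\<And>i. i < length es \<Longrightarrow> ends (es ! i) = {vs ! i, vs ! Suc i}"
    using p by (auto simp: graph_path_def graph_walk_def)
  have last: "last vs = vs ! length es"
    using len by (metis diff_Suc_1 last_conv_nth length_0_conv nat.distinct(1))
  then have "j \<noteq> length es" using j f by auto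
  then have jl: "j < length es" using j len by auto
  show False
  proof (cases "Suc j = length es")
    case True
    then have "last es = es ! j" using ne by (metis diff_Suc_1 last_conv_nth)
    then have "ends (last es) = ends f" using e[OF jl] True last f j by auto
    then show False using f inj_ends by (metis injD)
  next
    case False
    have "graph_path V ends (drop j vs) (drop j es)" using graph_path_drop[OF p] jl by simp
    moreover have "2 \<le> length (drop j es)" using False jl by simp
    moreover have "ends f = {hd (drop j vs), last (drop j vs)}"
      using f j by (auto simp: hd_drop_conv_nth)
    ultimately show False
      using tree unfolding one_three_tree_def graph_acyclic_def by blast
  qed
qed

section \<open>Leaf-paths\<close>

lemma leaf_pathI:
  assumes p: "graph_path V ends vs es" "es \<noteq> []"
    and "leaf V ends (hd vs)" "leaf V ends (last vs)"
  shows "leaf_path V ends vs es"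
proof -
  have len: "length vs = Suc (length es)"
    and e: "\<And>i. i < length es \<Longrightarrow> ends (es ! i) = {vs ! i, vs ! Suc i}"
    using p by (auto simp: graph_path_def graph_walk_def)
  have hd: "hd vs = vs ! 0" and last: "last vs = vs ! length es"
    using len by (metis hd_conv_nth length_0_conv nat.distinct(1),
        metis diff_Suc_1 last_conv_nth length_0_conv nat.distinct(1))
  have "hd es = es ! 0" "last es = es ! (length es - 1)"
    using p(2) by (auto simp: hd_conv_nth last_conv_nth)
  then have "hd vs \<in> ends (hd es)" "last vs \<in> ends (last es)"
    using e[of 0] e[of "length es - 1"] p(2) hd last by auto
  moreover have "\<forall>v\<in>set vs. leaf V ends v" if "length es = 1"
    using that len assms(3,4) hd last by (auto simp: in_set_conv_nth less_Suc_eq)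
  ultimately show ?thesis using assms by (auto simp: leaf_path_def leaf_edge_def)
qed

text \<open>\<open>leaf_edge\<close> only provides a leaf somewhere on the first edge. If there is a
  second edge, that leaf cannot be \<open>vs ! 1\<close>, which lies on two distinct edges; a single
  edge is settled by the last conjunct of \<open>leaf_path\<close>.\<close>

lemma leaf_path_hd:
  assumes "leaf_path V ends vs es"
  shows "leaf V ends (hd vs)"
proof -
  have p: "graph_path V ends vs es" and ne: "es \<noteq> []" and le: "leaf_edge V ends (hd es)"
    and one: "length es = 1 \<Longrightarrow> \<forall>v\<in>set vs. leaf V ends v"
    using assms by (auto simp: leaf_path_def)
  have len: "length vs = Suc (length es)"
    and e: "\<And>i. i < length es \<Longrightarrow> ends (es ! i) = {vs ! i, vs ! Suc i}"
    using p by (auto simp: graph_path_def graph_walk_def)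
  have hd: "hd vs = vs ! 0" using len by (metis hd_conv_nth length_0_conv nat.distinct(1))
  show ?thesis
  proof (cases "length es = 1")
    case True
    then show ?thesis using one hd len by auto
  next
    case False
    then have l: "1 < length es" using ne by (cases es) auto
    have "\<not> leaf V ends (vs ! 1)"
    proof
      assume "leaf V ends (vs ! 1)"
      then have "es ! 0 = es ! 1"
        using l e[of 0] e[of 1] by (intro leaf_edge_unique[of "vs ! 1"]) fastforce+
      then show False using graph_path_distinct_edges[OF p] l ne by (simp add: nth_eq_iff_index_eq)
    qed
    moreover have "hd es = es ! 0" using ne by (simp add: hd_conv_nth)
    ultimately show ?thesis using le e[of 0] l hd ne by (auto simp: leaf_edge_def)
  qed
qed

lemma leaf_path_rev:
  assumes "leaf_path V ends vs es"
  shows "leaf_path V ends (rev vs) (rev es)"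
  using assms graph_path_rev[of V ends vs es]
  by (auto simp: leaf_path_def hd_rev last_rev)

lemma leaf_path_last:
  assumes "leaf_path V ends vs es"
  shows "leaf V ends (last vs)"
  using leaf_path_hd[OF leaf_path_rev[OF assms]] by (simp add: hd_rev)

text \<open>Both end nodes of the path are leaves, so it enters and leaves an internal node by two
  consecutive edges.\<close>

lemma leaf_path_at_internal:
  assumes lp: "leaf_path V ends vs es" and v: "v \<in> set vs" "internal_node V ends v"
  obtains i where "Suc i < length es" "vs ! Suc i = v"
    "set es \<inter> incident_edges ends v = {es ! i, es ! Suc i}" "es ! i \<noteq> es ! Suc i"
proof -
  have p: "graph_path V ends vs es" using lp by (simp add: leaf_path_def)
  have len: "length vs = Suc (length es)"
    and e: "\<And>i. i < length es \<Longrightarrow> ends (es ! i) = {vs ! i, vs ! Suc i}"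
    using p by (auto simp: graph_path_def graph_walk_def)
  have hd: "hd vs = vs ! 0" and last: "last vs = vs ! length es"
    using len by (metis hd_conv_nth length_0_conv nat.distinct(1),
        metis diff_Suc_1 last_conv_nth length_0_conv nat.distinct(1))
  obtain j where j: "j < length vs" "vs ! j = v" using v by (auto simp: in_set_conv_nth)
  have "j \<noteq> 0" "j \<noteq> length es"
    using j hd last leaf_path_hd[OF lp] leaf_path_last[OF lp] leaf_not_internal v by metis+
  then obtain i where i: "j = Suc i" "Suc i < length es" using j len by (cases j) auto
  have "es ! i \<noteq> es ! Suc i"
    using graph_path_distinct_edges[OF p] i by (auto simp: nth_eq_iff_index_eq)
  moreover have "set es \<inter> incident_edges ends v = {es ! i, es ! Suc i}"
    using graph_path_incident_edge[OF p _ j(1)] j i e[of i] e[of "Suc i"] by fastforce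
  ultimately show ?thesis using that i j by auto
qed

text \<open>Take a longest path through \<open>e\<close> inside \<open>N\<close> with all
  transitions in \<open>R\<close>. At an internal end node \<open>ext\<close> would supply another
  edge, whose far end is new by \<open>next_edge_leaves_path\<close>. The lemma serves twice: with
  trivial \<open>R\<close> to decompose an edge set, and with \<open>R\<close> expressing that two
  edges can be perturbed together.\<close>

lemma leaf_path_through:
  fixes R :: "'v \<Rightarrow> 'e \<Rightarrow> 'e \<Rightarrow> bool"
  assumes "e \<in> N" and R_sym: "\<And>v a b. R v a b \<Longrightarrow> R v b a"
    and ext: "\<And>v a. internal_node V ends v \<Longrightarrow> v \<in> ends a \<Longrightarrow> a \<in> N \<Longrightarrow>
                \<exists>b\<in>N. b \<noteq> a \<and> v \<in> ends b \<and> R v a b"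
  obtains vs es where "leaf_path V ends vs es" "set es \<subseteq> N" "e \<in> set es"
    "\<And>i. Suc i < length es \<Longrightarrow> R (vs ! Suc i) (es ! i) (es ! Suc i)"
proof -
  define Q where "Q = (\<lambda>(vs, es). graph_path V ends vs es \<and> set es \<subseteq> N \<and> e \<in> set es \<and>
      (\<forall>i. Suc i < length es \<longrightarrow> R (vs ! Suc i) (es ! i) (es ! Suc i)))"
  obtain x y where xy: "ends e = {x, y}" "x \<noteq> y" using card_ends[of e] by (auto simp: card_2_iff)
  have "Q ([x, y], [e])"
    using xy ends_subset[of e] \<open>e \<in> N\<close> by (auto simp: Q_def graph_path_def graph_walk_def)
  \<comment> \<open>Path nodes are distinct, so lengths are bounded and a longest path
    exists.\<close>
  moreover have "length (snd p) < Suc (card V)" if "Q p" for p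
  proof -
    have "distinct (fst p)" "set (fst p) \<subseteq> V" "length (fst p) = Suc (length (snd p))"
      using that by (auto simp: Q_def graph_path_def graph_walk_def split: prod.splits)
    then show ?thesis using card_mono[OF finite_V, of "set (fst p)"] by (simp add: distinct_card)
  qed
  ultimately obtain p where "Q p" "\<And>q. Q q \<Longrightarrow> length (snd q) \<le> length (snd p)"
    using ex_has_greatest_nat[of Q _ "\<lambda>p. length (snd p)" "Suc (card V)"] by blast
  then obtain vs es where Q: "Q (vs, es)" and
    max: "\<And>vs' es'. Q (vs', es') \<Longrightarrow> length es' \<le> length es"
    by (metis prod.collapse snd_conv)
  \<comment> \<open>Reversal makes the argument for the last node apply to the first one too; this
    is what the symmetry of \<open>R\<close> is for.\<close>
  have Q_rev: "Q (rev vs, rev es)" if "Q (vs, es)" for vs es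
  proof -
    have len: "length vs = Suc (length es)"
      using that by (auto simp: Q_def graph_path_def graph_walk_def)
    have "R (rev vs ! Suc i) (rev es ! i) (rev es ! Suc i)" if i: "Suc i < length es" for i
    proof -
      \<comment> \<open>Transition \<open>i\<close> of the reversed path is transition
        \<open>?j\<close> of the original, read backwards.\<close>
      let ?j = "length es - Suc (Suc i)"
      have "rev es ! i = es ! Suc ?j" "rev es ! Suc i = es ! ?j" "rev vs ! Suc i = vs ! Suc ?j"
        using i len by (auto simp: rev_nth Suc_diff_Suc)
      moreover have "R (vs ! Suc ?j) (es ! ?j) (es ! Suc ?j)"
        using \<open>Q (vs, es)\<close> i by (auto simp: Q_def)
      ultimately show ?thesis using R_sym by simp
    qed
    with that graph_path_rev show ?thesis by (auto simp: Q_def)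
  qed
  \<comment> \<open>Stated for every path of the maximal length, so that it covers \<open>vs\<close>
    and its reversal.\<close>
  have last_leaf: "leaf V ends (last vs')" if Q': "Q (vs', es')" and l: "length es' = length es" for vs' es'
  proof (rule ccontr)
    assume nl: "\<not> leaf V ends (last vs')"
    have p: "graph_path V ends vs' es'" and N: "set es' \<subseteq> N" "e \<in> set es'"
      and R: "\<And>i. Suc i < length es' \<Longrightarrow> R (vs' ! Suc i) (es' ! i) (es' ! Suc i)"
      using Q' by (auto simp: Q_def)
    have ne: "es' \<noteq> []" using N by auto
    have len: "length vs' = Suc (length es')" and sub: "set vs' \<subseteq> V"
      and e': "\<And>i. i < length es' \<Longrightarrow> ends (es' ! i) = {vs' ! i, vs' ! Suc i}"
      using p by (auto simp: graph_path_def graph_walk_def)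
    have vs'_ne: "vs' \<noteq> []" using len by auto
    have lastv: "last vs' = vs' ! length es'" using len vs'_ne by (simp add: last_conv_nth)
    have laste: "last es' = es' ! (length es' - 1)" using ne by (simp add: last_conv_nth)
    have inc: "last vs' \<in> ends (last es')"
      using e'[of "length es' - 1"] ne lastv laste by auto
    have "internal_node V ends (last vs')"
      using leaf_or_internal nl sub vs'_ne last_in_set by blast
    moreover have "last es' \<in> N" using N ne by auto
    ultimately obtain b where b: "b \<in> N" "b \<noteq> last es'" "last vs' \<in> ends b" "R (last vs') (last es') b"
      using ext inc by blast
    obtain u where u: "ends b = {last vs', u}" "u \<noteq> last vs'" "u \<in> V" using other_end[OF b(3)] .
    have "u \<notin> set vs'" using next_edge_leaves_path[OF p ne u(1) b(2) u(2)] .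
    then have "graph_path V ends (vs' @ [u]) (es' @ [b])" using graph_path_snoc[OF p u(1)] u by blast
    moreover have "R ((vs' @ [u]) ! Suc i) ((es' @ [b]) ! i) ((es' @ [b]) ! Suc i)"
      if i: "Suc i < length (es' @ [b])" for i
    proof (cases "Suc i < length es'")
      case True
      then show ?thesis using R[of i] len by (simp add: nth_append)
    next
      case False
      then have "Suc i = length es'" using i by simp
      then have "i = length es' - 1" "i < length es'" by auto
      then show ?thesis using b(4) lastv laste len \<open>Suc i = length es'\<close> by (simp add: nth_append)
    qed
    ultimately have "Q (vs' @ [u], es' @ [b])" using N b by (auto simp: Q_def)
    from max[OF this] l show False by simp
  qed
  have "leaf V ends (last vs)" using last_leaf[OF Q] by simp
  moreover have "leaf V ends (hd vs)" using last_leaf[OF Q_rev[OF Q]] by (simp add: last_rev)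
  moreover have "es \<noteq> []" "graph_path V ends vs es" using Q by (auto simp: Q_def)
  ultimately have "leaf_path V ends vs es" by (intro leaf_pathI)
  with Q that show ?thesis by (auto simp: Q_def)
qed

section \<open>Connectivity and the edges at an internal node\<close>

text \<open>A walk that starts in \<open>S\<close> can never leave it, and walks reach every
  node.\<close>

lemma closed_node_set_eq_V:
  assumes "S \<subseteq> V" "S \<noteq> {}" and closed: "\<And>e. ends e \<inter> S \<noteq> {} \<Longrightarrow> ends e \<subseteq> S"
  shows "S = V"
proof -
  obtain u where u: "u \<in> S" using assms by auto
  have "x \<in> S" if x: "x \<in> V" for x
  proof -
    obtain vs es where w: "graph_walk V ends vs es" "hd vs = u" "last vs = x"
      using tree u x \<open>S \<subseteq> V\<close> unfolding one_three_tree_def graph_connected_def by (meson subsetD)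
    have len: "length vs = Suc (length es)"
      and e: "\<And>i. i < length es \<Longrightarrow> ends (es ! i) = {vs ! i, vs ! Suc i}"
      using w by (auto simp: graph_walk_def)
    have ne: "vs \<noteq> []" using len by auto
    have "vs ! i \<in> S" if "i \<le> length es" for i
      using that
    proof (induction i)
      case 0
      then show ?case using w u ne by (simp add: hd_conv_nth)
    next
      case (Suc i)
      then show ?case using e[of i] closed[of "es ! i"] by auto
    qed
    then show ?thesis using w len ne by (auto simp: last_conv_nth)
  qed
  then show ?thesis using assms(1) by auto
qed

text \<open>If both ends of \<open>e\<close> were leaves, no other edge would meet them. Then
  \<open>ends e\<close> would be closed under adjacency, hence all of \<open>V\<close>, with no room
  for a second edge.\<close>

lemma edge_has_internal_end:
  assumes "UNIV \<noteq> {e}"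
  shows "\<exists>v\<in>ends e. internal_node V ends v"
proof (rule ccontr)
  assume "\<not> ?thesis"
  then have lf: "\<And>v. v \<in> ends e \<Longrightarrow> leaf V ends v" using leaf_or_internal ends_subset by blast
  then have eq: "f = e" if "ends f \<inter> ends e \<noteq> {}" for f using that leaf_edge_unique by blast
  have "ends e = V"
    using eq card_ends[of e] ends_subset[of e] by (intro closed_node_set_eq_V) auto
  moreover have "ends f \<noteq> {}" "ends f \<subseteq> V" for f
    using card_ends[of f] ends_subset[of f] by auto
  ultimately have "f = e" for f using eq[of f] by blast
  then show False using assms by auto
qed

lemma internal_incident_edges:
  assumes "internal_node V ends v" "v \<in> ends a"
  obtains b c where "incident_edges ends v = {a, b, c}" "a \<noteq> b" "a \<noteq> c" "b \<noteq> c"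
proof -
  have "card (incident_edges ends v) = 3"
    using assms by (simp add: internal_node_def node_degree_def)
  then obtain x y z where "incident_edges ends v = {x, y, z}" "x \<noteq> y" "x \<noteq> z" "y \<noteq> z"
    by (auto simp: card_3_iff)
  moreover have "a \<in> incident_edges ends v" using assms by simp
  ultimately show ?thesis
    using that[of y z] that[of x z] that[of x y] by (auto simp: insert_commute)
qed

lemma internal_triple_distinct:
  assumes "internal_node V ends v" "incident_edges ends v = {a, b, c}"
  shows "a \<noteq> b" "a \<noteq> c" "b \<noteq> c"
proof -
  have "card {a, b, c} = 3" using assms by (simp add: internal_node_def node_degree_def)
  then show "a \<noteq> b" "a \<noteq> c" "b \<noteq> c" by (auto simp: card_insert_if split: if_splits)
qed

section \<open>Points of the polytope with coordinates 0 and 1/2\<close>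

text \<open>At an internal end of \<open>e\<close>, adding the triangle inequalities for the other
  two edges gives the lower bound; adding the one for \<open>e\<close> to the perimeter inequality
  gives the upper bound.\<close>

lemma tree_polytope_bounds:
  assumes "w \<in> tree_polytope V ends"
  shows "0 \<le> w $ e" "w $ e \<le> 1 / 2"
proof -
  have "0 \<le> w $ e \<and> w $ e \<le> 1 / 2"
  proof (cases "UNIV = {e}")
    case True
    then show ?thesis using assms by (auto simp: tree_polytope_def)
  next
    case False
    then obtain v where v: "v \<in> ends e" "internal_node V ends v"
      using edge_has_internal_end by blast
    then obtain b c where "incident_edges ends v = {e, b, c}"
      using internal_incident_edges by metis
    then have "w $ e \<le> w $ b + w $ c \<and> w $ b \<le> w $ e + w $ c \<and> w $ c \<le> w $ e + w $ b \<and>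
        w $ e + w $ b + w $ c \<le> 1"
      using assms v unfolding tree_polytope_def by blast
    then show ?thesis by linarith
  qed
  then show "0 \<le> w $ e" "w $ e \<le> 1 / 2" by auto
qed

text \<open>For three values in {0, 1}, the triangle inequalities rule out exactly the sum 1, and
  the doubled perimeter bound 2 rules out exactly the sum 3. The bounds for a single-edge tree hold
  automatically.\<close>

lemma half_char_vec_mem_tree_polytope_iff:
  "(1 / 2) *\<^sub>R char_vec F \<in> tree_polytope V ends \<longleftrightarrow>
     (\<forall>v. internal_node V ends v \<longrightarrow> card (F \<inter> incident_edges ends v) \<in> {0, 2})"
    (is "?l \<longleftrightarrow> ?r")
proof -
  have *: "card (F \<inter> {a, b, c}) \<in> {0, 2} \<longleftrightarrow>
      (let x = indicator F a :: real; y = indicator F b; z = indicator F c in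
        x \<le> y + z \<and> y \<le> x + z \<and> z \<le> x + y \<and> x + y + z \<le> 2)"
    if "a \<noteq> b" "a \<noteq> c" "b \<noteq> c" for a b c
    using that by (cases "a \<in> F"; cases "b \<in> F"; cases "c \<in> F") (auto simp: Let_def)
  have mem: "?l \<longleftrightarrow> (\<forall>v a b c. internal_node V ends v \<and> incident_edges ends v = {a, b, c} \<longrightarrow>
      (let x = indicator F a :: real; y = indicator F b; z = indicator F c in
        x \<le> y + z \<and> y \<le> x + z \<and> z \<le> x + y \<and> x + y + z \<le> 2))"
  proof -
    have "(0::real) \<le> 1 / 2 * indicator F e \<and> 1 / 2 * indicator F e \<le> (1 / 2 :: real)" for e
      by (simp add: indicator_def)
    moreover have "1 / 2 * x \<le> 1 / 2 * y + 1 / 2 * z \<longleftrightarrow> x \<le> y + z"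
      "1 / 2 * x + 1 / 2 * y + 1 / 2 * z \<le> 1 \<longleftrightarrow> x + y + z \<le> 2" for x y z :: real by auto
    ultimately show ?thesis
      by (simp only: tree_polytope_def char_vec_def Let_def mem_Collect_eq vector_scaleR_component
          vec_lambda_beta real_scaleR_def simp_thms)
  qed
  show ?thesis
  proof
    assume l: ?l
    show ?r
    proof (intro allI impI)
      fix v assume v: "internal_node V ends v"
      then obtain a b c where abc: "incident_edges ends v = {a, b, c}"
        by (auto simp: internal_node_def node_degree_def card_3_iff)
      show "card (F \<inter> incident_edges ends v) \<in> {0, 2}"
        using l[unfolded mem, rule_format, OF conjI[OF v abc]] *[OF internal_triple_distinct[OF v abc]]
        unfolding abc by blast
    qed
  next
    assume r: ?r
    show ?l
      unfolding mem
    proof (intro allI impI, elim conjE)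
      fix v a b c assume v: "internal_node V ends v" and abc: "incident_edges ends v = {a, b, c}"
      show "let x = indicator F a :: real; y = indicator F b; z = indicator F c in
        x \<le> y + z \<and> y \<le> x + z \<and> z \<le> x + y \<and> x + y + z \<le> 2"
        using r[rule_format, OF v] *[OF internal_triple_distinct[OF v abc]] unfolding abc by blast
    qed
  qed
qed

lemma half_char_vec_extreme_point:
  assumes w: "(1 / 2) *\<^sub>R char_vec F \<in> tree_polytope V ends" (is "?w \<in> _")
  shows "?w extreme_point_of tree_polytope V ends"
  unfolding extreme_point_of_def
proof (intro conjI ballI w notI)
  fix a b assume a: "a \<in> tree_polytope V ends" and b: "b \<in> tree_polytope V ends"
    and "?w \<in> open_segment a b"
  then obtain u where ne: "a \<noteq> b" and u: "0 < u" "u < 1" "?w = (1 - u) *\<^sub>R a + u *\<^sub>R b"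
    by (auto simp: in_segment)
  have "a $ e = b $ e" for e
  proof -
    have eq: "indicator F e / 2 = (1 - u) * (a $ e) + u * (b $ e)"
      using arg_cong[OF u(3), of "\<lambda>w. w $ e"] by (simp add: char_vec_def)
    note bds = tree_polytope_bounds[OF a, of e] tree_polytope_bounds[OF b, of e]
    \<comment> \<open>Applied to the distances from 1/2 if \<open>e\<close> lies in
      \<open>F\<close>, and from 0 otherwise: a proper convex combination reaches a bound only if
      both points do.\<close>
    have *: "x = 0 \<and> y = 0" if "(1 - u) * x + u * y = 0" "0 \<le> x" "0 \<le> y" for x y
      using that u by (simp add: add_nonneg_eq_0_iff)
    show ?thesis
    proof (cases "e \<in> F")
      case True
      then have "(1 - u) * (1/2 - a $ e) + u * (1/2 - b $ e) = 0" using eq by (simp add: field_simps)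
      then show ?thesis using *[of "1/2 - a $ e" "1/2 - b $ e"] bds by simp
    next
      case False
      then show ?thesis using *[of "a $ e" "b $ e"] eq bds by simp
    qed
  qed
  then show False using ne by (simp add: vec_eq_iff)
qed

section \<open>Collections of disjoint leaf-paths as edge sets\<close>

text \<open>By disjointness at most one path of \<open>H\<close> visits \<open>v\<close>, and it has
  two edges there because its end nodes are leaves.\<close>

lemma disjoint_leaf_paths_even:
  assumes H: "disjoint_leaf_paths V ends H" and v: "internal_node V ends v"
  shows "card (edges_of H \<inter> incident_edges ends v) \<in> {0, 2}"
proof (cases "\<exists>vs es. (vs, es) \<in> H \<and> v \<in> set vs")
  case False
  have "edges_of H \<inter> incident_edges ends v = {}"
  proof -
    have "v \<notin> ends e" if "(vs, es) \<in> H" "e \<in> set es" for vs es e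
      using that H False graph_path_edge_ends_subset[of V ends vs es e]
      by (auto simp: disjoint_leaf_paths_def leaf_path_def)
    then show ?thesis by (auto simp: edges_of_def)
  qed
  then show ?thesis by simp
next
  case True
  then obtain vs es where p: "(vs, es) \<in> H" "v \<in> set vs" by auto
  have lp: "leaf_path V ends vs es" using H p by (auto simp: disjoint_leaf_paths_def)
  have "e \<in> set es" if e: "e \<in> set es'" "(vs', es') \<in> H" "v \<in> ends e" for e vs' es'
  proof -
    have "leaf_path V ends vs' es'" using H e by (auto simp: disjoint_leaf_paths_def)
    then have "v \<in> set vs'" using e graph_path_edge_ends_subset[of V ends vs' es' e]
      by (auto simp: leaf_path_def)
    then have "(vs', es') = (vs, es)"
      using H p e unfolding disjoint_leaf_paths_def pairwise_def disjnt_def by fastforce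
    then show ?thesis using e by simp
  qed
  then have "edges_of H \<inter> incident_edges ends v = set es \<inter> incident_edges ends v"
    using p by (auto simp: edges_of_def)
  moreover obtain i where "set es \<inter> incident_edges ends v = {es ! i, es ! Suc i}" "es ! i \<noteq> es ! Suc i"
    using leaf_path_at_internal[OF lp p(2) v] .
  ultimately show ?thesis by simp
qed

text \<open>Nothing in \<open>F\<close> branches off the path: at an internal node its two edges are
  already all that \<open>F\<close> has there, and at a leaf there is only one edge.\<close>

lemma leaf_path_absorbs_edges:
  assumes lp: "leaf_path V ends vs es" and F: "set es \<subseteq> F"
    and even: "\<And>v. internal_node V ends v \<Longrightarrow> card (F \<inter> incident_edges ends v) \<in> {0, 2}"
    and f: "f \<in> F" "v \<in> ends f" "v \<in> set vs"
  shows "f \<in> set es"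
proof (cases "leaf V ends v")
  case True
  have p: "graph_path V ends vs es" and ne: "es \<noteq> []" using lp by (auto simp: leaf_path_def)
  obtain j where j: "j < length vs" "vs ! j = v" using f by (auto simp: in_set_conv_nth)
  have len: "length vs = Suc (length es)"
    and e: "\<And>i. i < length es \<Longrightarrow> ends (es ! i) = {vs ! i, vs ! Suc i}"
    using p by (auto simp: graph_path_def graph_walk_def)
  have "\<exists>i<length es. v \<in> ends (es ! i)"
  proof (cases "j < length es")
    case True
    then show ?thesis using e[of j] j by auto
  next
    case False
    then have "j = length es" using j len by auto
    then show ?thesis using e[of "length es - 1"] j ne by (intro exI[of _ "length es - 1"]) auto
  qed
  then show ?thesis using leaf_edge_unique[OF True f(2)] by auto
next
  case False
  have "v \<in> V" using f ends_subset by auto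
  then have v: "internal_node V ends v" using False leaf_or_internal by auto
  obtain i where i: "set es \<inter> incident_edges ends v = {es ! i, es ! Suc i}" "es ! i \<noteq> es ! Suc i"
    using leaf_path_at_internal[OF lp f(3) v] .
  have fin: "finite (F \<inter> incident_edges ends v)" by simp
  have sub: "set es \<inter> incident_edges ends v \<subseteq> F \<inter> incident_edges ends v" using F by auto
  have "card (set es \<inter> incident_edges ends v) = 2" using i by simp
  then have "set es \<inter> incident_edges ends v = F \<inter> incident_edges ends v"
    using even[OF v] card_mono[OF fin sub] by (intro card_subset_eq[OF fin sub]) auto
  moreover have "f \<in> F \<inter> incident_edges ends v" using f by simp
  ultimately show ?thesis by blast
qed

text \<open>By absorption, an edge of \<open>F\<close> with one end on the first path has both ends
  on it. So membership in \<open>set vs\<close> is constant along the second path.\<close>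

lemma leaf_path_node_sets_subset:
  assumes even: "\<And>v. internal_node V ends v \<Longrightarrow> card (F \<inter> incident_edges ends v) \<in> {0, 2}"
    and p: "leaf_path V ends vs es" "set es \<subseteq> F" and q: "leaf_path V ends vs' es'" "set es' \<subseteq> F"
    and meet: "set vs \<inter> set vs' \<noteq> {}"
  shows "set vs' \<subseteq> set vs"
proof -
  have len: "length vs' = Suc (length es')"
    and e: "\<And>i. i < length es' \<Longrightarrow> ends (es' ! i) = {vs' ! i, vs' ! Suc i}"
    using q by (auto simp: leaf_path_def graph_path_def graph_walk_def)
  have step: "vs' ! i \<in> set vs \<longleftrightarrow> vs' ! Suc i \<in> set vs" if "i < length es'" for i
  proof -
    have "es' ! i \<in> F" using q that by auto
    moreover have "ends (es' ! i) \<subseteq> set vs" if "es' ! i \<in> set es"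
      using that p(1) graph_path_edge_ends_subset unfolding leaf_path_def by metis
    ultimately show ?thesis using leaf_path_absorbs_edges[OF p even] e[OF that] by blast
  qed
  have all: "vs' ! i \<in> set vs \<longleftrightarrow> vs' ! 0 \<in> set vs" if "i \<le> length es'" for i
    using that by (induction i) (auto simp: step[symmetric])
  obtain j where "j \<le> length es'" "vs' ! j \<in> set vs" using meet len
    by (auto simp: in_set_conv_nth[of _ vs'] less_Suc_eq_le)
  then have "vs' ! i \<in> set vs" if "i \<le> length es'" for i using all that by blast
  then show ?thesis using len by (auto simp: in_set_conv_nth[of _ vs'] less_Suc_eq_le)
qed

text \<open>Every edge of \<open>F\<close> lies on a leaf-path inside \<open>F\<close>, and two such
  paths that meet have the same node set. One path is kept per node set, since a path and its
  reversal would violate disjointness.\<close>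

lemma even_edge_set_decomposition:
  assumes even: "\<And>v. internal_node V ends v \<Longrightarrow> card (F \<inter> incident_edges ends v) \<in> {0, 2}"
  obtains H where "disjoint_leaf_paths V ends H" "edges_of H = F"
proof -
  define A where "A = {(vs, es). leaf_path V ends vs es \<and> set es \<subseteq> F}"
  define rep where "rep S = (SOME p. p \<in> A \<and> set (fst p) = S)" for S
  define H where "H = rep ` (\<lambda>p. set (fst p)) ` A"
  have rep: "rep (set (fst p)) \<in> A \<and> set (fst (rep (set (fst p)))) = set (fst p)" if "p \<in> A" for p
    unfolding rep_def using that by (rule_tac someI[of _ p]) auto
  have same: "set (fst p) = set (fst q)" if "p \<in> A" "q \<in> A" "set (fst p) \<inter> set (fst q) \<noteq> {}" for p q
  proof -
    have p: "leaf_path V ends (fst p) (snd p)" "set (snd p) \<subseteq> F"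
      and q: "leaf_path V ends (fst q) (snd q)" "set (snd q) \<subseteq> F"
      using that by (auto simp: A_def)
    show ?thesis
      using leaf_path_node_sets_subset[OF even p q] leaf_path_node_sets_subset[OF even q p] that(3)
      by (simp add: Int_commute subset_antisym)
  qed
  have HA: "H \<subseteq> A" using rep by (auto simp: H_def)
  have "disjnt (set (fst p)) (set (fst q))" if pq: "p \<in> H" "q \<in> H" "p \<noteq> q" for p q
  proof (rule ccontr)
    assume "\<not> ?thesis"
    then have "set (fst p) = set (fst q)" using same[of p q] pq HA by (auto simp: disjnt_def)
    \<comment> \<open>Members of \<open>H\<close> are recovered from their node sets, so equal node
      sets mean equal paths.\<close>
    moreover have "rep (set (fst x)) = x" if "x \<in> H" for x using that rep by (auto simp: H_def)
    ultimately show False using pq by metis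
  qed
  then have "disjoint_leaf_paths V ends H"
    using HA by (auto simp: disjoint_leaf_paths_def pairwise_def A_def)
  moreover have "edges_of H = F"
  proof
    show "edges_of H \<subseteq> F" using HA by (auto simp: edges_of_def A_def)
    show "F \<subseteq> edges_of H"
    proof
      fix e assume e: "e \<in> F"
      \<comment> \<open>Evenness excludes a single edge of \<open>F\<close> at \<open>v\<close>. The
        conjunct \<open>True\<close> stands for the trivial relation given to
        \<open>leaf_path_through\<close>.\<close>
      have "\<exists>b\<in>F. b \<noteq> a \<and> v \<in> ends b \<and> True"
        if a: "internal_node V ends v" "v \<in> ends a" "a \<in> F" for v a
      proof (rule ccontr)
        assume "\<not> ?thesis"
        then have "F \<inter> incident_edges ends v = {a}" using a by auto
        then show False using even[OF a(1)] by simp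
      qed
      then obtain vs es where p: "leaf_path V ends vs es" "set es \<subseteq> F" "e \<in> set es"
        using leaf_path_through[OF e, of "\<lambda>_ _ _. True"] by metis
      then have pA: "(vs, es) \<in> A" by (simp add: A_def)
      \<comment> \<open>The representative may differ from \<open>(vs, es)\<close>, but it visits
        the ends of \<open>e\<close> and therefore absorbs \<open>e\<close>.\<close>
      define q where "q = rep (set vs)"
      have q: "q \<in> A" "set (fst q) = set vs" "q \<in> H"
        using rep[OF pA] pA by (auto simp: q_def H_def)
      have "ends e \<subseteq> set vs" using p(1,3) graph_path_edge_ends_subset unfolding leaf_path_def by metis
      moreover obtain v where "v \<in> ends e" using card_ends[of e] by fastforce
      ultimately have "e \<in> set (snd q)"
        using q e leaf_path_absorbs_edges[OF _ _ even, of "fst q" "snd q"] by (auto simp: A_def)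
      then show "e \<in> edges_of H" using q(3) by (cases q) (auto simp: edges_of_def)
    qed
  qed
  ultimately show ?thesis using that by blast
qed

section \<open>Perturbation of fractional points\<close>

lemma tree_polytope_iff:
  "w \<in> tree_polytope V ends \<longleftrightarrow>
     (\<forall>v. internal_node V ends v \<longrightarrow> node_constraint w (incident_edges ends v)) \<and>
     (\<forall>e. UNIV = {e} \<longrightarrow> 0 \<le> w $ e \<and> w $ e \<le> 1 / 2)"
proof -
  have "(\<forall>a b c. incident_edges ends v = {a, b, c} \<longrightarrow>
        w $ a \<le> w $ b + w $ c \<and> w $ b \<le> w $ a + w $ c \<and> w $ c \<le> w $ a + w $ b \<and>
        w $ a + w $ b + w $ c \<le> 1) \<longleftrightarrow> node_constraint w (incident_edges ends v)" (is "?l \<longleftrightarrow> ?r")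
    if v: "internal_node V ends v" for v
  proof
    assume l: ?l
    obtain a b c where abc: "incident_edges ends v = {a, b, c}"
      using v by (auto simp: internal_node_def node_degree_def card_3_iff)
    then show ?r using l node_constraint_triple[OF internal_triple_distinct[OF v abc], of w] by simp
  next
    assume r: ?r
    show ?l
    proof (intro allI impI)
      fix a b c assume abc: "incident_edges ends v = {a, b, c}"
      then show "w $ a \<le> w $ b + w $ c \<and> w $ b \<le> w $ a + w $ c \<and> w $ c \<le> w $ a + w $ b \<and>
        w $ a + w $ b + w $ c \<le> 1"
        using r node_constraint_triple[OF internal_triple_distinct[OF v abc], of w] by simp
    qed
  qed
  then show ?thesis unfolding tree_polytope_def by blast
qed

lemma perturbation_exists:
  assumes w: "w \<in> tree_polytope V ends" and e: "0 < w $ e" "w $ e < 1 / 2"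
  obtains d \<epsilon> where "d \<noteq> 0" "0 < \<epsilon>" "\<And>t. \<bar>t\<bar> \<le> \<epsilon> \<Longrightarrow> w + t *\<^sub>R d \<in> tree_polytope V ends"
proof -
  define N where "N = {e. 0 < w $ e \<and> w $ e < 1 / 2}"
  \<comment> \<open>Here \<open>s\<close> is the speed of \<open>b\<close> relative to
    \<open>a\<close>. It stays explicit so that speeds can be multiplied along a path.\<close>
  define G where "G v a b s \<longleftrightarrow> s \<in> {1, -1} \<and> (\<exists>\<epsilon>>0. \<forall>t. \<bar>t\<bar> \<le> \<epsilon> \<longrightarrow>
      node_constraint (w + t *\<^sub>R (axis a 1 + s *\<^sub>R axis b 1)) (incident_edges ends v))" for v a b s
  define R where "R v a b \<longleftrightarrow> (\<exists>s. G v a b s)" for v a b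
  have R_sym: "R v b a" if ab: "R v a b" for v a b
  proof -
    obtain s \<epsilon> where s: "s \<in> {1, -1}" "\<epsilon> > 0" and n: "\<And>t. \<bar>t\<bar> \<le> \<epsilon> \<Longrightarrow>
      node_constraint (w + t *\<^sub>R (axis a 1 + s *\<^sub>R axis b 1)) (incident_edges ends v)"
      using ab unfolding R_def G_def by blast
    have "node_constraint (w + t *\<^sub>R (axis b 1 + s *\<^sub>R axis a 1)) (incident_edges ends v)"
      if "\<bar>t\<bar> \<le> \<epsilon>" for t
    proof -
      \<comment> \<open>Since \<open>s * s = 1\<close>, exchanging the two edges only scales the
        direction by \<open>s\<close>.\<close>
      have "t *\<^sub>R (axis b 1 + s *\<^sub>R axis a 1) = (t * s) *\<^sub>R (axis a 1 + s *\<^sub>R axis b 1 :: real ^ 'e)"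
        using s(1) by (auto simp: algebra_simps)
      moreover have "\<bar>t * s\<bar> \<le> \<epsilon>" using that s(1) by auto
      ultimately show ?thesis using n by simp
    qed
    then show ?thesis using s unfolding R_def G_def by blast
  qed
  have ext: "\<exists>b\<in>N. b \<noteq> a \<and> v \<in> ends b \<and> R v a b"
    if v: "internal_node V ends v" "v \<in> ends a" and a: "a \<in> N" for v a
  proof -
    obtain b c where abc: "incident_edges ends v = {a, b, c}" "a \<noteq> b" "a \<noteq> c" "b \<noteq> c"
      using internal_incident_edges[OF v] .
    have "node_constraint w {a, b, c}" using w v abc(1) tree_polytope_iff by metis
    then obtain b' s \<epsilon> where b': "b' \<in> {b, c}" and "0 < w $ b'" "w $ b' < 1 / 2" "s \<in> {1, -1}" "0 < \<epsilon>"
      "\<And>t. \<bar>t\<bar> \<le> \<epsilon> \<Longrightarrow> node_constraint (w + t *\<^sub>R (axis a 1 + s *\<^sub>R axis b' 1)) {a, b, c}"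
      using node_constraint_perturbation[OF abc(2-4)] a unfolding N_def by blast
    then have "b' \<in> N" "R v a b'" unfolding N_def R_def G_def abc(1) by blast+
    moreover have "b' \<noteq> a" using b' abc(2,3) by auto
    moreover have "b' \<in> incident_edges ends v" using b' abc(1) by auto
    ultimately show ?thesis by auto
  qed
  have "e \<in> N" using e by (simp add: N_def)
  from leaf_path_through[of e N R, OF this R_sym ext]
  obtain vs es where lp: "leaf_path V ends vs es" and esN: "set es \<subseteq> N" "e \<in> set es"
    and R: "\<And>i. Suc i < length es \<Longrightarrow> R (vs ! Suc i) (es ! i) (es ! Suc i)" by blast
  have p: "graph_path V ends vs es" using lp by (simp add: leaf_path_def)
  obtain s where s: "\<And>i. Suc i < length es \<Longrightarrow> G (vs ! Suc i) (es ! i) (es ! Suc i) (s i)"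
    using R unfolding R_def by metis
  \<comment> \<open>The speed of the edge at position \<open>i\<close> when the first edge has speed
    1; consecutive speeds have ratio \<open>s i\<close>.\<close>
  define \<sigma> where "\<sigma> i = (\<Prod>j<i. s j)" for i
  have \<sigma>: "\<sigma> i \<in> {1, -1}" if "i < length es" for i
    using that
  proof (induction i)
    case 0
    then show ?case by (simp add: \<sigma>_def)
  next
    case (Suc i)
    then show ?case using s[of i] by (auto simp: \<sigma>_def G_def)
  qed
  \<comment> \<open>The edges of the path are distinct, so at most one summand is nonzero; off the
    path \<open>d\<close> vanishes.\<close>
  define d :: "real ^ 'e" where "d = (\<chi> f. \<Sum>i<length es. if es ! i = f then \<sigma> i else 0)"
  have d_on: "d $ (es ! i) = \<sigma> i" if "i < length es" for i
  proof -
    have "d $ (es ! i) = (\<Sum>k<length es. if k = i then \<sigma> k else 0)"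
      unfolding d_def vec_lambda_beta using graph_path_distinct_edges[OF p] that
      by (intro sum.cong) (auto simp: nth_eq_iff_index_eq)
    then show ?thesis using that by simp
  qed
  have d_off: "d $ f = 0" if "f \<notin> set es" for f
    using that by (auto simp: d_def intro!: sum.neutral)
  \<comment> \<open>The radius may still depend on \<open>v\<close>; \<open>uniform_radius\<close>
    removes this below. Off the path nothing moves.\<close>
  have "\<exists>\<epsilon>>0. \<forall>t. \<bar>t\<bar> \<le> \<epsilon> \<longrightarrow> internal_node V ends v \<longrightarrow>
      node_constraint (w + t *\<^sub>R d) (incident_edges ends v)" for v
  proof (cases "internal_node V ends v \<and> v \<in> set vs")
    case False
    have "node_constraint (w + t *\<^sub>R d) (incident_edges ends v)" if v: "internal_node V ends v" for t
    proof -
      have "d $ f = 0" if "f \<in> incident_edges ends v" for f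
        using that False v graph_path_edge_ends_subset[OF p] by (intro d_off) auto
      then have "node_constraint (w + t *\<^sub>R d) (incident_edges ends v) =
          node_constraint w (incident_edges ends v)"
        by (intro node_constraint_cong) simp
      then show ?thesis using w v by (simp add: tree_polytope_iff)
    qed
    then show ?thesis by (intro exI[of _ 1]) simp
  next
    case True
    then obtain i where i: "Suc i < length es" "vs ! Suc i = v"
      "set es \<inter> incident_edges ends v = {es ! i, es ! Suc i}" "es ! i \<noteq> es ! Suc i"
      using leaf_path_at_internal[OF lp] by blast
    obtain \<epsilon> where \<epsilon>: "\<epsilon> > 0" and n: "\<And>t. \<bar>t\<bar> \<le> \<epsilon> \<Longrightarrow>
      node_constraint (w + t *\<^sub>R (axis (es ! i) 1 + s i *\<^sub>R axis (es ! Suc i) 1)) (incident_edges ends v)"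
      using s[OF i(1)] i(2) by (auto simp: G_def)
    have "node_constraint (w + t *\<^sub>R d) (incident_edges ends v)" if "\<bar>t\<bar> \<le> \<epsilon>" for t
    proof -
      \<comment> \<open>At \<open>v\<close>, \<open>d\<close> is the local direction times a sign,
        which leaves the radius unchanged; the third edge at \<open>v\<close> is off the
        path.\<close>
      have "d $ f = \<sigma> i * (axis (es ! i) 1 + s i *\<^sub>R axis (es ! Suc i) 1) $ f"
        if f: "f \<in> incident_edges ends v" for f
      proof -
        consider "f = es ! i" | "f = es ! Suc i" | "f \<notin> set es" "f \<noteq> es ! i" "f \<noteq> es ! Suc i"
          using i(1,3) f by fastforce
        then show ?thesis
          by cases (use i d_on[of i] d_on[of "Suc i"] d_off[of f] in \<open>auto simp: axis_def \<sigma>_def\<close>)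
      qed
      then have "node_constraint (w + t *\<^sub>R d) (incident_edges ends v) = node_constraint
         (w + (t * \<sigma> i) *\<^sub>R (axis (es ! i) 1 + s i *\<^sub>R axis (es ! Suc i) 1)) (incident_edges ends v)"
        by (intro node_constraint_cong) simp
      moreover have "\<bar>t * \<sigma> i\<bar> \<le> \<epsilon>" using \<sigma>[of i] i(1) that by auto
      ultimately show ?thesis using n by simp
    qed
    then show ?thesis using \<epsilon> by blast
  qed
  then obtain \<epsilon>1 where \<epsilon>1: "\<epsilon>1 > 0" "\<And>v t. v \<in> V \<Longrightarrow> \<bar>t\<bar> \<le> \<epsilon>1 \<Longrightarrow> internal_node V ends v \<Longrightarrow>
      node_constraint (w + t *\<^sub>R d) (incident_edges ends v)"
    using uniform_radius[OF finite_V, of "\<lambda>v t. internal_node V ends v \<longrightarrow>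
      node_constraint (w + t *\<^sub>R d) (incident_edges ends v)"] by blast
  obtain k where k: "k < length es" "e = es ! k" using esN by (auto simp: in_set_conv_nth)
  then have de: "d $ e \<in> {1, -1}" using d_on \<sigma> by simp
  \<comment> \<open>The last two terms handle the tree with a single edge, which has no internal
    node and only the explicit bounds.\<close>
  define \<epsilon> where "\<epsilon> = min \<epsilon>1 (min (w $ e) (1 / 2 - w $ e))"
  have "w + t *\<^sub>R d \<in> tree_polytope V ends" if t: "\<bar>t\<bar> \<le> \<epsilon>" for t
    unfolding tree_polytope_iff
  proof (intro conjI allI impI)
    fix v assume "internal_node V ends v"
    then show "node_constraint (w + t *\<^sub>R d) (incident_edges ends v)"
      using \<epsilon>1(2)[of v t] t by (auto simp: \<epsilon>_def internal_node_def)
  next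
    fix f :: 'e assume "UNIV = {f}"
    then have "f = e" by auto
    then show "0 \<le> (w + t *\<^sub>R d) $ f" "(w + t *\<^sub>R d) $ f \<le> 1 / 2"
      using de t by (auto simp: \<epsilon>_def)
  qed
  moreover have "\<epsilon> > 0" using \<epsilon>1 e by (simp add: \<epsilon>_def)
  moreover have "d \<noteq> 0" using de by auto
  ultimately show ?thesis using that by blast
qed

text \<open>Otherwise \<open>w\<close> would be the midpoint of two distinct points of the polytope,
  obtained by moving along \<open>d\<close> in both directions.\<close>

lemma extreme_point_half_integral:
  assumes w: "w extreme_point_of tree_polytope V ends"
  shows "w $ e \<in> {0, 1 / 2}"
proof (rule ccontr)
  assume "\<not> ?thesis"
  moreover have mem: "w \<in> tree_polytope V ends" using w by (simp add: extreme_point_of_def)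
  ultimately have "0 < w $ e" "w $ e < 1 / 2"
    using tree_polytope_bounds[OF mem, of e] by auto
  then obtain d \<epsilon> where d: "d \<noteq> 0" "0 < \<epsilon>"
    and P: "\<And>t. \<bar>t\<bar> \<le> \<epsilon> \<Longrightarrow> w + t *\<^sub>R d \<in> tree_polytope V ends"
    using perturbation_exists[OF mem] by metis
  let ?a = "w + (- \<epsilon>) *\<^sub>R d" and ?b = "w + \<epsilon> *\<^sub>R d"
  have "?a \<noteq> ?b"
  proof
    assume "?a = ?b"
    then have "(2 * \<epsilon>) *\<^sub>R d = 0" by (simp add: algebra_simps scaleR_2 flip: scaleR_scaleR)
    then show False using d by simp
  qed
  moreover have "midpoint ?a ?b = w" by (simp add: midpoint_def algebra_simps scaleR_2[symmetric])
  ultimately have "w \<in> open_segment ?a ?b"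
    using midpoint_in_open_segment[of ?a ?b] by simp
  moreover have "?a \<in> tree_polytope V ends" "?b \<in> tree_polytope V ends"
    using P[of "- \<epsilon>"] P[of \<epsilon>] d by auto
  ultimately show False using w unfolding extreme_point_of_def by blast
qed

end

theorem theorem3:
  fixes V :: "'v set" and ends :: "'e::finite \<Rightarrow> 'v set"
  assumes "one_three_tree V ends"
  shows "{w. w extreme_point_of tree_polytope V ends} =
         {(1 / 2) *\<^sub>R char_vec (edges_of H) | H. disjoint_leaf_paths V ends H}"
proof -
  interpret one_three_tree_graph V ends using assms by unfold_locales
  show ?thesis
  proof (intro equalityI subsetI)
    fix w assume "w \<in> {w. w extreme_point_of tree_polytope V ends}"
    then have w: "w extreme_point_of tree_polytope V ends" by simp
    \<comment> \<open>All coordinates being 0 or 1/2, this set determines \<open>w\<close>.\<close>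
    define F where "F = {e. w $ e = 1 / 2}"
    have w_eq: "w = (1 / 2) *\<^sub>R char_vec F"
      using extreme_point_half_integral[OF w]
      by (auto simp: vec_eq_iff char_vec_def F_def indicator_def)
    have "(1 / 2) *\<^sub>R char_vec F \<in> tree_polytope V ends"
      using w w_eq by (simp add: extreme_point_of_def)
    then obtain H where "disjoint_leaf_paths V ends H" "edges_of H = F"
      using even_edge_set_decomposition[of F] half_char_vec_mem_tree_polytope_iff by blast
    then show "w \<in> {(1 / 2) *\<^sub>R char_vec (edges_of H) | H. disjoint_leaf_paths V ends H}"
      using w_eq by blast
  next
    fix w assume "w \<in> {(1 / 2) *\<^sub>R char_vec (edges_of H) | H. disjoint_leaf_paths V ends H}"
    then obtain H where "disjoint_leaf_paths V ends H" "w = (1 / 2) *\<^sub>R char_vec (edges_of H)"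
      by blast
    then show "w \<in> {w. w extreme_point_of tree_polytope V ends}"
      using half_char_vec_extreme_point half_char_vec_mem_tree_polytope_iff disjoint_leaf_paths_even
      by blast
  qed
qed

end
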